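(* Let $M$ be a smoothly embedded submanifold of $\mathbb{R}^m$ equipped with a Riemannian metric $g$, and let $z=(z_1,\dots,z_m):M\hookrightarrow\mathbb{R}^m$ denote the inclusion map. Then $\{\mathrm{grad}(z_i)\}_{i=1}^m$ is a generating set for the smooth vector fields on $M$, where $\mathrm{grad}$ denotes the Riemannian gradient with respect to $g$.
   Context: The metric $g$ is not assumed to be inherited from $\mathbb{R}^m$. A finite set $\{X_i\}_{i=1}^m$ of smooth vector fields on $M$ is a generating set if every smooth vector field $X$ on $M$ can be written $X=f_1X_1+\cdots+f_mX_m$ with $f_i\in C^\infty(M)$. *)

theory Defs
  imports "HOL-Analysis.Analysis"
begin

section \<open>Smooth maps\<close>

text \<open>Meant for open \<open>U\<close>, where these are the usual \<open>C\<^sup>k\<close> and \<open>C\<^sup>\<infinity>\<close> notions.\<close>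

primrec Ck_on :: "nat \<Rightarrow> 'a::euclidean_space set \<Rightarrow> ('a \<Rightarrow> 'b::euclidean_space) \<Rightarrow> bool" where
  "Ck_on 0 U f \<longleftrightarrow> continuous_on U f"
| "Ck_on (Suc k) U f \<longleftrightarrow> (\<forall>x\<in>U. f differentiable (at x)) \<and>
     (\<forall>v. Ck_on k U (\<lambda>x. frechet_derivative f (at x) v))"

definition Cinf_on :: "'a::euclidean_space set \<Rightarrow> ('a \<Rightarrow> 'b::euclidean_space) \<Rightarrow> bool" where
  "Cinf_on U f \<longleftrightarrow> (\<forall>k. Ck_on k U f)"

text \<open>Smoothness on an arbitrary subset of Euclidean space: local existence of smooth extensions
  to open sets. On an embedded submanifold this is smoothness in the sense of manifolds.\<close>

definition smooth_map :: "'a::euclidean_space set \<Rightarrow> ('a \<Rightarrow> 'b::euclidean_space) \<Rightarrow> bool" where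
  "smooth_map M f \<longleftrightarrow>
     (\<forall>p\<in>M. \<exists>W F. open W \<and> p \<in> W \<and> Cinf_on W F \<and> (\<forall>x\<in>M \<inter> W. F x = f x))"

section \<open>Embedded submanifolds\<close>

definition diffeo :: "'a::euclidean_space set \<Rightarrow> 'b::euclidean_space set \<Rightarrow>
    ('a \<Rightarrow> 'b) \<Rightarrow> ('b \<Rightarrow> 'a) \<Rightarrow> bool" where
  "diffeo U V \<phi> \<psi> \<longleftrightarrow>
     open U \<and> open V \<and> homeomorphism U V \<phi> \<psi> \<and> Cinf_on U \<phi> \<and> Cinf_on V \<psi>"

text \<open>The local slice condition. As the coordinates need not be ordered, the slice is given by
  a \<open>k\<close>-element set \<open>J\<close> of free coordinates, the others being zero.\<close>

definition embedded_submanifold :: "nat \<Rightarrow> (real ^ 'm) set \<Rightarrow> bool" where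
  "embedded_submanifold k M \<longleftrightarrow>
     (\<forall>p\<in>M. \<exists>U (V :: (real ^ 'm) set) \<phi> \<psi> (J :: 'm set).
        p \<in> U \<and> diffeo U V \<phi> \<psi> \<and> card J = k \<and>
        \<phi> ` (M \<inter> U) = {y \<in> V. \<forall>i. i \<notin> J \<longrightarrow> y $ i = 0})"

section \<open>Tangent spaces, vector fields and differentials\<close>

definition curve_in :: "'a::euclidean_space set \<Rightarrow> 'a \<Rightarrow> 'a \<Rightarrow> (real \<Rightarrow> 'a) \<Rightarrow> bool" where
  "curve_in M p v \<gamma> \<longleftrightarrow>
     (\<exists>e>0. Cinf_on {-e<..<e} \<gamma> \<and> \<gamma> ` {-e<..<e} \<subseteq> M) \<and> \<gamma> 0 = p \<and>
     (\<gamma> has_vector_derivative v) (at 0)"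

definition tangent_space :: "'a::euclidean_space set \<Rightarrow> 'a \<Rightarrow> 'a set" where
  "tangent_space M p = {v. \<exists>\<gamma>. curve_in M p v \<gamma>}"

definition smooth_vector_field :: "'a::euclidean_space set \<Rightarrow> ('a \<Rightarrow> 'a) \<Rightarrow> bool" where
  "smooth_vector_field M X \<longleftrightarrow> smooth_map M X \<and> (\<forall>p\<in>M. X p \<in> tangent_space M p)"

definition generating_set ::
    "'a::euclidean_space set \<Rightarrow> ('i::finite \<Rightarrow> 'a \<Rightarrow> 'a) \<Rightarrow> bool" where
  "generating_set M Xs \<longleftrightarrow> (\<forall>i. smooth_vector_field M (Xs i)) \<and>
     (\<forall>X. smooth_vector_field M X \<longrightarrow>
        (\<exists>f :: 'i \<Rightarrow> 'a \<Rightarrow> real. (\<forall>i. smooth_map M (f i)) \<and>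
           (\<forall>p\<in>M. X p = (\<Sum>i\<in>UNIV. f i p *\<^sub>R Xs i p))))"

definition differential :: "'a::euclidean_space set \<Rightarrow> ('a \<Rightarrow> real) \<Rightarrow> 'a \<Rightarrow> 'a \<Rightarrow> real" where
  "differential M f p v =
     (THE d. \<forall>\<gamma>. curve_in M p v \<gamma> \<longrightarrow> ((\<lambda>t. f (\<gamma> t)) has_real_derivative d) (at 0))"

section \<open>Riemannian metrics and gradients\<close>

text \<open>Only the values of \<open>g p\<close> on the tangent space at \<open>p\<close> matter. Smoothness is tested on
  smooth vector fields over relatively open subsets, which include all coordinate frames.\<close>

definition riemannian_metric ::
    "'a::euclidean_space set \<Rightarrow> ('a \<Rightarrow> 'a \<Rightarrow> 'a \<Rightarrow> real) \<Rightarrow> bool" where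
  "riemannian_metric M g \<longleftrightarrow>
     (\<forall>p\<in>M. \<forall>u\<in>tangent_space M p. \<forall>v\<in>tangent_space M p.
        g p u v = g p v u \<and> (u \<noteq> 0 \<longrightarrow> g p u u > 0) \<and>
        (\<forall>w\<in>tangent_space M p. \<forall>a b.
           g p (a *\<^sub>R u + b *\<^sub>R v) w = a * g p u w + b * g p v w)) \<and>
     (\<forall>W X Y. open W \<and> smooth_vector_field (M \<inter> W) X \<and> smooth_vector_field (M \<inter> W) Y \<longrightarrow>
        smooth_map (M \<inter> W) (\<lambda>p. g p (X p) (Y p)))"

definition grad ::
    "'a::euclidean_space set \<Rightarrow> ('a \<Rightarrow> 'a \<Rightarrow> 'a \<Rightarrow> real) \<Rightarrow> ('a \<Rightarrow> real) \<Rightarrow> 'a \<Rightarrow> 'a" where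
  "grad M g f p =
     (THE w. w \<in> tangent_space M p \<and> (\<forall>v\<in>tangent_space M p. g p w v = differential M f p v))"

end

theory Submission
  imports Defs
begin

text \<open>Let \<open>P\<close> be the Euclidean orthogonal projection onto the tangent spaces. A vector field \<open>X\<close> is
  recovered as \<open>X = (\<Sum>i. g X (P e\<^sub>i) grad z\<^sub>i)\<close>: paired with a tangent vector \<open>v\<close>, the right-hand side
  is \<open>\<Sum>i. g X (P e\<^sub>i) v\<^sub>i = g X (P v) = g X v\<close>. These coefficients are global, so no partition of unity
  is needed. Since \<open>P e\<^sub>i\<close> is the gradient of \<open>z\<^sub>i\<close> for the Euclidean metric, all that remains is
  smoothness of the gradients of the \<open>z\<^sub>i\<close> for an arbitrary metric. In the frame given by a slice
  chart their coefficients solve a linear system whose matrix is the Gram matrix of the frame.\<close>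

section \<open>Calculus of smooth maps\<close>

text \<open>Near \<open>x\<close> the two functions admit the same derivatives, so the choice
  operator inside \<open>frechet_derivative\<close> sees the same predicate. Hence differentiability
  need not be assumed.\<close>

lemma frechet_derivative_cong_open:
  assumes "open U" "x \<in> U" "\<And>y. y \<in> U \<Longrightarrow> f y = g y"
  shows "frechet_derivative f (at x) = frechet_derivative g (at x)"
proof -
  have "(f has_derivative D) (at x) \<longleftrightarrow> (g has_derivative D) (at x)" for D
    using assms has_derivative_transform_within_open[of f D x UNIV U g]
      has_derivative_transform_within_open[of g D x UNIV U f] by auto
  then show ?thesis
    unfolding frechet_derivative_def by simp
qed

lemma Ck_on_cong:
  assumes "open U" "\<And>x. x \<in> U \<Longrightarrow> f x = g x" "Ck_on k U f"
  shows "Ck_on k U g"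
  using assms
proof (induction k arbitrary: f g)
  case 0
  then show ?case
    using continuous_on_cong[of U U f g] by simp
next
  case (Suc k)
  have "g differentiable (at x)" if "x \<in> U" for x
  proof -
    have "f differentiable (at x)"
      using Suc.prems that by simp
    then show ?thesis
      using has_derivative_transform_within_open[OF _ \<open>open U\<close> that] Suc.prems(2)
      unfolding differentiable_def by metis
  qed
  moreover have "Ck_on k U (\<lambda>x. frechet_derivative g (at x) v)" for v
  proof (rule Suc.IH[OF \<open>open U\<close>])
    show "Ck_on k U (\<lambda>x. frechet_derivative f (at x) v)"
      using Suc.prems by simp
  qed (use frechet_derivative_cong_open[OF \<open>open U\<close> _ Suc.prems(2)] in auto)
  ultimately show ?case
    by simp
qed

text \<open>Replaces \<open>frechet_derivative\<close> by an explicit derivative formula; the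
  inductive closure proofs below all go through it.\<close>

lemma Ck_on_SucI:
  assumes "open U" "\<And>x. x \<in> U \<Longrightarrow> (f has_derivative D x) (at x)"
    and "\<And>v. Ck_on k U (\<lambda>x. D x v)"
  shows "Ck_on (Suc k) U f"
proof -
  have "Ck_on k U (\<lambda>x. frechet_derivative f (at x) v)" for v
    by (rule Ck_on_cong[OF \<open>open U\<close> _ assms(3)[of v]])
      (metis assms(2) frechet_derivative_at)
  then show ?thesis
    using assms(2) by (auto simp: differentiable_def)
qed

lemma Ck_on_has_derivative:
  "Ck_on (Suc k) U f \<Longrightarrow> x \<in> U \<Longrightarrow> (f has_derivative frechet_derivative f (at x)) (at x)"
  using frechet_derivative_works by auto

text \<open>Product, quotient and chain rules leave undifferentiated factors in the derivative;
  those must be lowered by one order before an induction hypothesis applies.\<close>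

lemma Ck_on_SucD: "Ck_on (Suc k) U f \<Longrightarrow> Ck_on k U f"
proof (induction k arbitrary: f)
  case 0
  then show ?case
    by (auto intro!: continuous_at_imp_continuous_on differentiable_imp_continuous_within)
next
  case (Suc k)
  then show ?case
    using Ck_on.simps(2) by blast
qed

lemma Ck_on_subset: "Ck_on k U f \<Longrightarrow> V \<subseteq> U \<Longrightarrow> Ck_on k V f"
  by (induction k arbitrary: f) (auto intro: continuous_on_subset)

lemma Ck_on_const: "Ck_on k U (\<lambda>x. c)"
  by (induction k arbitrary: c) auto

lemma Ck_on_bounded_linear: "bounded_linear f \<Longrightarrow> open U \<Longrightarrow> Ck_on k U f"
  by (cases k)
    (auto simp: linear_continuous_on simp del: Ck_on.simps(2)
      intro!: Ck_on_SucI[where D = "\<lambda>_. f"] Ck_on_const bounded_linear_imp_has_derivative)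

lemma Ck_on_add: "open U \<Longrightarrow> Ck_on k U f \<Longrightarrow> Ck_on k U g \<Longrightarrow> Ck_on k U (\<lambda>x. f x + g x)"
proof (induction k arbitrary: f g)
  case 0
  then show ?case
    by (simp add: continuous_on_add)
next
  case (Suc k)
  show ?case
  proof (rule Ck_on_SucI[OF \<open>open U\<close>])
    show "((\<lambda>x. f x + g x) has_derivative
        (\<lambda>v. frechet_derivative f (at x) v + frechet_derivative g (at x) v)) (at x)" if "x \<in> U" for x
      using that Suc.prems Ck_on_has_derivative by (blast intro: has_derivative_add)
    show "Ck_on k U (\<lambda>x. frechet_derivative f (at x) v + frechet_derivative g (at x) v)" for v
      using Suc by simp
  qed
qed

lemma Ck_on_sum:
  "open U \<Longrightarrow> (\<And>i. i \<in> A \<Longrightarrow> Ck_on k U (f i)) \<Longrightarrow> Ck_on k U (\<lambda>x. \<Sum>i\<in>A. f i x)"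
  by (induction A rule: infinite_finite_induct) (auto intro: Ck_on_const Ck_on_add)

lemma Ck_on_bounded_bilinear:
  fixes f :: "'a::euclidean_space \<Rightarrow> 'b::euclidean_space" and g :: "'a \<Rightarrow> 'c::euclidean_space"
    and h :: "'b \<Rightarrow> 'c \<Rightarrow> 'd::euclidean_space"
  assumes h: "bounded_bilinear h" and "open U" "Ck_on k U f" "Ck_on k U g"
  shows "Ck_on k U (\<lambda>x. h (f x) (g x))"
  using assms(3,4)
proof (induction k arbitrary: f g)
  case 0
  then show ?case
    by (simp add: bounded_bilinear.continuous_on[OF h])
next
  case (Suc k)
  show ?case
  proof (rule Ck_on_SucI[OF \<open>open U\<close>])
    show "((\<lambda>x. h (f x) (g x)) has_derivative
        (\<lambda>v. h (f x) (frechet_derivative g (at x) v) + h (frechet_derivative f (at x) v) (g x)))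
        (at x)" if "x \<in> U" for x
      using that Suc.prems
      by (intro bounded_bilinear.FDERIV[OF h] Ck_on_has_derivative[where U = U])
    show "Ck_on k U (\<lambda>x. h (f x) (frechet_derivative g (at x) v) +
        h (frechet_derivative f (at x) v) (g x))" for v
      using Suc.prems
      by (intro Ck_on_add Suc.IH \<open>open U\<close> Ck_on_SucD[OF Suc.prems(1)] Ck_on_SucD[OF Suc.prems(2)])
        simp_all
  qed
qed

lemmas Ck_on_scaleR = Ck_on_bounded_bilinear[OF bounded_bilinear_scaleR]
lemmas Ck_on_mult = Ck_on_bounded_bilinear[OF bounded_bilinear_mult]
lemmas Ck_on_inner = Ck_on_bounded_bilinear[OF bounded_bilinear_inner]

lemma Ck_on_inverse:
  fixes f :: "'a::euclidean_space \<Rightarrow> real"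
  assumes "open U" "Ck_on k U f" "\<And>x. x \<in> U \<Longrightarrow> f x \<noteq> 0"
  shows "Ck_on k U (\<lambda>x. inverse (f x))"
  using assms(2)
proof (induction k)
  case 0
  then show ?case
    using assms(3) by (auto intro: continuous_on_inverse)
next
  case (Suc k)
  show ?case
  proof (rule Ck_on_SucI[OF \<open>open U\<close>])
    \<comment> \<open>Writing the derivative with two factors \<open>inverse (f x)\<close>, rather
      than a squared denominator, lets the induction hypothesis apply to each of them.\<close>
    show "((\<lambda>x. inverse (f x)) has_derivative
        (\<lambda>v. (- 1) * (inverse (f x) * frechet_derivative f (at x) v * inverse (f x)))) (at x)"
      if "x \<in> U" for x
      using Deriv.has_derivative_inverse[OF assms(3)[OF that] Ck_on_has_derivative[OF Suc.prems that]]
      by simp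
    show "Ck_on k U (\<lambda>x. (- 1) * (inverse (f x) * frechet_derivative f (at x) v * inverse (f x)))" for v
      using Suc.prems
      by (intro Ck_on_mult Ck_on_const \<open>open U\<close> Suc.IH Ck_on_SucD[OF Suc.prems]) simp_all
  qed
qed

lemma Ck_on_compose:
  fixes f :: "'a::euclidean_space \<Rightarrow> 'b::euclidean_space" and g :: "'b \<Rightarrow> 'c::euclidean_space"
  assumes "open U" "f ` U \<subseteq> V" "Ck_on k U f" "Ck_on k V g"
  shows "Ck_on k U (\<lambda>x. g (f x))"
  using assms(3,4)
proof (induction k arbitrary: g)
  case 0
  then show ?case
    using assms(2) continuous_on_compose2[of V g U f] by simp
next
  case (Suc k)
  show ?case
  proof (rule Ck_on_SucI[OF \<open>open U\<close>])
    \<comment> \<open>\<open>Ck_on\<close> controls derivatives only in a fixed direction, whereas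
      the chain rule applies the derivative of \<open>g\<close> in the varying direction given by
      the derivative of \<open>f\<close>. Expanding this direction in the basis leaves
      \<open>g\<close> differentiated along fixed \<open>b\<close>, and the induction hypothesis
      covers that composite.\<close>
    let ?D = "\<lambda>x v. \<Sum>b\<in>Basis. (frechet_derivative f (at x) v \<bullet> b) *\<^sub>R frechet_derivative g (at (f x)) b"
    show "((\<lambda>x. g (f x)) has_derivative ?D x) (at x)" if "x \<in> U" for x
    proof -
      have g: "(g has_derivative frechet_derivative g (at (f x))) (at (f x))"
        using that assms(2) Suc.prems Ck_on_has_derivative by blast
      interpret g: linear "frechet_derivative g (at (f x))"
        using g has_derivative_linear by blast
      have D: "frechet_derivative g (at (f x)) (frechet_derivative f (at x) v) = ?D x v" for v
      proof -
        have "?D x v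
            = frechet_derivative g (at (f x)) (\<Sum>b\<in>Basis. (frechet_derivative f (at x) v \<bullet> b) *\<^sub>R b)"
          by (simp only: g.sum g.scaleR)
        then show ?thesis
          by (simp only: euclidean_representation)
      qed
      show ?thesis
        using has_derivative_compose[OF Ck_on_has_derivative[OF Suc.prems(1) that] g]
        unfolding D .
    qed
    show "Ck_on k U (\<lambda>x. ?D x v)" for v
    proof (intro Ck_on_sum Ck_on_scaleR Ck_on_inner Ck_on_const \<open>open U\<close>)
      show "Ck_on k U (\<lambda>x. frechet_derivative f (at x) v)"
        using Suc.prems(1) by simp
      show "Ck_on k U (\<lambda>x. frechet_derivative g (at (f x)) b)" for b
        using Suc.prems(2) by (intro Suc.IH[OF Ck_on_SucD[OF Suc.prems(1)]]) simp
    qed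
  qed
qed

lemma Cinf_on_frechet_derivative:
  "Cinf_on U f \<Longrightarrow> Cinf_on U (\<lambda>x. frechet_derivative f (at x) v)"
  unfolding Cinf_on_def by (metis Ck_on.simps(2))

lemma Cinf_on_has_derivative:
  "Cinf_on U f \<Longrightarrow> x \<in> U \<Longrightarrow> (f has_derivative frechet_derivative f (at x)) (at x)"
  unfolding Cinf_on_def using Ck_on_has_derivative by blast

lemma Cinf_on_compose:
  assumes "open U" "f ` U \<subseteq> V" "Cinf_on U f" "Cinf_on V g"
  shows "Cinf_on U (\<lambda>x. g (f x))"
  unfolding Cinf_on_def
proof
  show "Ck_on k U (\<lambda>x. g (f x))" for k
    by (rule Ck_on_compose[OF assms(1,2)]) (use assms(3,4) in \<open>simp_all add: Cinf_on_def\<close>)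
qed

section \<open>Smooth maps on arbitrary subsets of Euclidean space\<close>

lemma smooth_mapI_Cinf_on: "open U \<Longrightarrow> Cinf_on U f \<Longrightarrow> N \<subseteq> U \<Longrightarrow> smooth_map N f"
  unfolding smooth_map_def by blast

lemma smooth_map_cong:
  "smooth_map N f \<Longrightarrow> (\<And>x. x \<in> N \<Longrightarrow> f x = g x) \<Longrightarrow> smooth_map N g"
  unfolding smooth_map_def by simp

lemma smooth_map_local:
  assumes "\<And>p. p \<in> N \<Longrightarrow> \<exists>W. open W \<and> p \<in> W \<and> smooth_map (N \<inter> W) f"
  shows "smooth_map N f"
  unfolding smooth_map_def
proof
  fix p assume "p \<in> N"
  then obtain W where W: "open W" "p \<in> W" "smooth_map (N \<inter> W) f"
    using assms by blast
  then obtain W' F where W': "open W'" "p \<in> W'" "Cinf_on W' F" "\<forall>x\<in>N \<inter> W \<inter> W'. F x = f x"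
    using \<open>p \<in> N\<close> unfolding smooth_map_def by blast
  have "Cinf_on (W \<inter> W') F"
    using W'(3) Ck_on_subset unfolding Cinf_on_def by blast
  then show "\<exists>W F. open W \<and> p \<in> W \<and> Cinf_on W F \<and> (\<forall>x\<in>N \<inter> W. F x = f x)"
    using W W' by (intro exI[of _ "W \<inter> W'"] exI[of _ F]) auto
qed

lemma smooth_map_const: "smooth_map N (\<lambda>x. c)"
  by (rule smooth_mapI_Cinf_on[of UNIV]) (auto simp: Cinf_on_def Ck_on_const)

text \<open>The operation is applied to local extensions of \<open>f\<close> and \<open>g\<close> on
  the intersection of their domains. One argument thus serves addition and every bounded bilinear
  product.\<close>

lemma smooth_map_lift2:
  fixes f :: "'a::euclidean_space \<Rightarrow> 'b::euclidean_space" and g :: "'a \<Rightarrow> 'c::euclidean_space"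
    and h :: "'b \<Rightarrow> 'c \<Rightarrow> 'd::euclidean_space"
  assumes op: "\<And>k U (f :: 'a \<Rightarrow> 'b) (g :: 'a \<Rightarrow> 'c).
      open U \<Longrightarrow> Ck_on k U f \<Longrightarrow> Ck_on k U g \<Longrightarrow> Ck_on k U (\<lambda>x. h (f x) (g x))"
    and f: "smooth_map N f" and g: "smooth_map N g"
  shows "smooth_map N (\<lambda>x. h (f x) (g x))"
  unfolding smooth_map_def
proof
  fix p assume "p \<in> N"
  obtain V F where V: "open V" "p \<in> V" "Cinf_on V F" "\<forall>x\<in>N \<inter> V. F x = f x"
    using f \<open>p \<in> N\<close> unfolding smooth_map_def by blast
  obtain W G where W: "open W" "p \<in> W" "Cinf_on W G" "\<forall>x\<in>N \<inter> W. G x = g x"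
    using g \<open>p \<in> N\<close> unfolding smooth_map_def by blast
  have "Ck_on k (V \<inter> W) (\<lambda>x. h (F x) (G x))" for k
  proof (rule op)
    show "open (V \<inter> W)"
      using V W by blast
    show "Ck_on k (V \<inter> W) F" "Ck_on k (V \<inter> W) G"
      using V(3) W(3) Ck_on_subset unfolding Cinf_on_def by blast+
  qed
  then have "Cinf_on (V \<inter> W) (\<lambda>x. h (F x) (G x))"
    unfolding Cinf_on_def by blast
  then show "\<exists>W F. open W \<and> p \<in> W \<and> Cinf_on W F \<and> (\<forall>x\<in>N \<inter> W. F x = h (f x) (g x))"
    using V W by (intro exI[of _ "V \<inter> W"] exI[of _ "\<lambda>x. h (F x) (G x)"]) auto
qed

lemma smooth_map_add:
  "smooth_map N f \<Longrightarrow> smooth_map N g \<Longrightarrow> smooth_map N (\<lambda>x. f x + g x)"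
  by (rule smooth_map_lift2[where h = "(+)"]) (rule Ck_on_add)

lemma smooth_map_bounded_bilinear:
  "bounded_bilinear h \<Longrightarrow> smooth_map N f \<Longrightarrow> smooth_map N g \<Longrightarrow> smooth_map N (\<lambda>x. h (f x) (g x))"
  by (rule smooth_map_lift2[where h = h]) (rule Ck_on_bounded_bilinear[where h = h])

lemmas smooth_map_scaleR = smooth_map_bounded_bilinear[OF bounded_bilinear_scaleR]
lemmas smooth_map_mult = smooth_map_bounded_bilinear[OF bounded_bilinear_mult]
lemmas smooth_map_inner = smooth_map_bounded_bilinear[OF bounded_bilinear_inner]

lemma smooth_map_sum:
  "(\<And>i. i \<in> A \<Longrightarrow> smooth_map N (f i)) \<Longrightarrow> smooth_map N (\<lambda>x. \<Sum>i\<in>A. f i x)"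
  by (induction A rule: infinite_finite_induct) (auto intro: smooth_map_const smooth_map_add)

lemma smooth_map_prod:
  fixes f :: "'i \<Rightarrow> 'a::euclidean_space \<Rightarrow> real"
  shows "(\<And>i. i \<in> A \<Longrightarrow> smooth_map N (f i)) \<Longrightarrow> smooth_map N (\<lambda>x. \<Prod>i\<in>A. f i x)"
  by (induction A rule: infinite_finite_induct) (auto intro: smooth_map_const smooth_map_mult)

lemma smooth_map_inverse:
  fixes f :: "'a::euclidean_space \<Rightarrow> real"
  assumes f: "smooth_map N f" and nz: "\<And>x. x \<in> N \<Longrightarrow> f x \<noteq> 0"
  shows "smooth_map N (\<lambda>x. inverse (f x))"
  unfolding smooth_map_def
proof
  fix p assume "p \<in> N"
  then obtain V F where V: "open V" "p \<in> V" "Cinf_on V F" "\<forall>x\<in>N \<inter> V. F x = f x"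
    using f unfolding smooth_map_def by blast
  \<comment> \<open>The extension \<open>F\<close> may vanish at points outside \<open>N\<close>, so
    its domain is cut down to the open set where it is nonzero.\<close>
  define W where "W = V \<inter> F -` (- {0})"
  have "continuous_on V F"
    using V(3) Ck_on.simps(1) unfolding Cinf_on_def by blast
  then have "open W"
    unfolding W_def using V(1) by (simp add: continuous_open_preimage open_Compl)
  moreover have "Cinf_on W (\<lambda>x. inverse (F x))"
    unfolding Cinf_on_def
    using V(3) Ck_on_subset[of _ V F W] \<open>open W\<close>
    by (intro allI Ck_on_inverse) (auto simp: W_def Cinf_on_def)
  ultimately show "\<exists>W F. open W \<and> p \<in> W \<and> Cinf_on W F \<and> (\<forall>x\<in>N \<inter> W. F x = inverse (f x))"
    using V nz[OF \<open>p \<in> N\<close>] \<open>p \<in> N\<close>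
    by (intro exI[of _ W] exI[of _ "\<lambda>x. inverse (F x)"]) (auto simp: W_def)
qed

lemma smooth_map_vec_nth:
  fixes f :: "'a::euclidean_space \<Rightarrow> real ^ 'n"
  shows "smooth_map N f \<Longrightarrow> smooth_map N (\<lambda>x. f x $ i)"
  using smooth_map_inner[OF _ smooth_map_const[of N "axis i 1"], of f] by (simp add: inner_axis)

lemma smooth_map_det:
  fixes A :: "'a::euclidean_space \<Rightarrow> real ^ 'n ^ 'n"
  assumes "\<And>i j. smooth_map N (\<lambda>x. A x $ i $ j)"
  shows "smooth_map N (\<lambda>x. det (A x))"
  unfolding det_def using assms
  by (intro smooth_map_sum smooth_map_mult smooth_map_prod smooth_map_const)

text \<open>Cramer's rule gives the solution as quotients of determinants, which are polynomials in
  the smooth entries; this makes the solution smooth in \<open>x\<close>, not merely existent at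
  each point.\<close>

lemma smooth_map_linear_system:
  fixes A :: "'a::euclidean_space \<Rightarrow> real ^ 'n ^ 'n"
  assumes A: "\<And>i j. smooth_map N (\<lambda>x. A x $ i $ j)" and b: "\<And>i. smooth_map N (\<lambda>x. b x $ i)"
    and nz: "\<And>x. x \<in> N \<Longrightarrow> det (A x) \<noteq> 0"
  shows "\<exists>c. (\<forall>i. smooth_map N (\<lambda>x. c x $ i)) \<and> (\<forall>x\<in>N. A x *v c x = b x)"
proof (intro exI conjI allI ballI)
  let ?c = "\<lambda>x. \<chi> k. det (\<chi> i j. if j = k then b x $ i else A x $ i $ j) / det (A x)"
  show "A x *v ?c x = b x" if "x \<in> N" for x
    using cramer[OF nz[OF that]] by blast
  have num: "smooth_map N (\<lambda>x. det (\<chi> i j. if j = k then b x $ i else A x $ i $ j))" for k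
  proof (rule smooth_map_det)
    show "smooth_map N (\<lambda>x. (\<chi> i j. if j = k then b x $ i else A x $ i $ j) $ i $ j)" for i j
      using A b by (cases "j = k") simp_all
  qed
  have "smooth_map N (\<lambda>x. det (A x))"
    using A by (rule smooth_map_det)
  then show "smooth_map N (\<lambda>x. ?c x $ k)" for k
    using smooth_map_mult[OF num smooth_map_inverse[OF _ nz]] by (simp add: divide_inverse)
qed

section \<open>Inner products on subspaces\<close>

text \<open>Nothing is known of \<open>h\<close> off \<open>T\<close>, just as a metric is
  constrained only on tangent spaces. This is why the rules below carry membership conditions;
  linearity in the second argument comes from symmetry.\<close>

locale inner_product_on =
  fixes T :: "'a::euclidean_space set" and h :: "'a \<Rightarrow> 'a \<Rightarrow> real"
  assumes subspace: "subspace T"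
    and sym: "u \<in> T \<Longrightarrow> v \<in> T \<Longrightarrow> h u v = h v u"
    and pos: "u \<in> T \<Longrightarrow> u \<noteq> 0 \<Longrightarrow> h u u > 0"
    and lin: "u \<in> T \<Longrightarrow> v \<in> T \<Longrightarrow> w \<in> T \<Longrightarrow> h (a *\<^sub>R u + b *\<^sub>R v) w = a * h u w + b * h v w"
begin

lemma sum_in: "(\<And>i. i \<in> A \<Longrightarrow> B i \<in> T) \<Longrightarrow> (\<Sum>i\<in>A. c i *\<^sub>R B i) \<in> T"
  by (simp add: subspace subspace_scale subspace_sum)

lemma zero_left: "w \<in> T \<Longrightarrow> h 0 w = 0"
  using lin[of w w w 0 0] by simp

lemma sum_left:
  assumes "\<And>i. i \<in> A \<Longrightarrow> B i \<in> T" "w \<in> T"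
  shows "h (\<Sum>i\<in>A. c i *\<^sub>R B i) w = (\<Sum>i\<in>A. c i * h (B i) w)"
  using assms(1)
proof (induction A rule: infinite_finite_induct)
  case (insert x F)
  then show ?case
    using lin[of "B x" "\<Sum>i\<in>F. c i *\<^sub>R B i" w "c x" 1] sum_in[of F B c] assms(2) by simp
qed (use zero_left assms in auto)

lemma sum_right:
  assumes "\<And>i. i \<in> A \<Longrightarrow> B i \<in> T" "w \<in> T"
  shows "h w (\<Sum>i\<in>A. c i *\<^sub>R B i) = (\<Sum>i\<in>A. c i * h w (B i))"
proof -
  have "h w (\<Sum>i\<in>A. c i *\<^sub>R B i) = h (\<Sum>i\<in>A. c i *\<^sub>R B i) w"
    using assms by (intro sym sum_in)
  also have "\<dots> = (\<Sum>i\<in>A. c i * h (B i) w)"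
    using assms by (rule sum_left)
  also have "\<dots> = (\<Sum>i\<in>A. c i * h w (B i))"
    using assms sym by (intro sum.cong) auto
  finally show ?thesis .
qed

text \<open>Nondegeneracy: the difference lies in \<open>T\<close> and is orthogonal to itself, so
  positivity makes it zero.\<close>

lemma eqI:
  assumes "u \<in> T" "v \<in> T" "\<And>w. w \<in> T \<Longrightarrow> h u w = h v w"
  shows "u = v"
proof (rule ccontr)
  assume "u \<noteq> v"
  have d: "u - v \<in> T"
    using assms subspace subspace_diff by blast
  have "h (u - v) (u - v) = h u (u - v) - h v (u - v)"
    using lin[OF assms(1,2) d, of 1 "- 1"] by simp
  also have "\<dots> = 0"
    using assms(3)[OF d] by simp
  finally show False
    using pos[OF d] \<open>u \<noteq> v\<close> by simp
qed

end

text \<open>The Gram matrix is padded by the identity outside \<open>J\<close>, so that Cramer's rule for the fixed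
  index type applies.\<close>

definition gram :: "('a \<Rightarrow> 'a \<Rightarrow> real) \<Rightarrow> 'n set \<Rightarrow> ('n \<Rightarrow> 'a) \<Rightarrow> real ^ 'n ^ 'n" where
  "gram h J B = (\<chi> a b. if a \<in> J \<and> b \<in> J then h (B a) (B b) else if a = b then 1 else 0)"

lemma gram_mult_in:
  assumes "a \<in> J"
  shows "(gram h J B *v c) $ a = (\<Sum>b\<in>J. h (B a) (B b) * c $ b)"
proof -
  have "(gram h J B *v c) $ a = (\<Sum>b\<in>UNIV. if b \<in> J then h (B a) (B b) * c $ b else 0)"
    unfolding gram_def matrix_vector_mult_def using assms by (auto intro!: sum.cong)
  then show ?thesis
    by (simp add: sum.If_cases)
qed

lemma gram_mult_out:
  assumes "a \<notin> J"
  shows "(gram h J B *v c) $ a = c $ a"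
  using assms by (simp add: gram_def matrix_vector_mult_def if_distrib[of "\<lambda>x. x * _"] cong: if_cong)

text \<open>The kernel is trivial. For \<open>c\<close> in the kernel, the combination of the
  \<open>B a\<close> with coefficients \<open>c\<close> has zero \<open>h\<close>-square, hence
  vanishes. Independence then kills the entries in \<open>J\<close>, and the identity padding kills
  the others.\<close>

lemma (in inner_product_on) det_gram_nonzero:
  assumes B: "\<And>a. a \<in> J \<Longrightarrow> B a \<in> T"
    and indep: "\<And>c :: real ^ 'n. (\<Sum>a\<in>J. c $ a *\<^sub>R B a) = 0 \<Longrightarrow> (\<forall>a\<in>J. c $ a = 0)"
  shows "det (gram h J B :: real ^ 'n ^ 'n) \<noteq> 0"
proof -
  have "c = 0" if c: "gram h J B *v c = 0" for c :: "real ^ 'n"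
  proof -
    let ?w = "\<Sum>a\<in>J. c $ a *\<^sub>R B a"
    have w: "?w \<in> T"
      using B by (rule sum_in)
    have "h ?w ?w = (\<Sum>a\<in>J. c $ a * h (B a) ?w)"
      using B w by (rule sum_left)
    also have "\<dots> = (\<Sum>a\<in>J. c $ a * (gram h J B *v c) $ a)"
      using B by (auto simp: sum_right gram_mult_in mult.commute intro!: sum.cong)
    finally have "?w = 0"
      using pos[OF w] c by force
    then have "c $ a = 0" for a
      using indep[of c] gram_mult_out[of a J h B c] c by (cases "a \<in> J") auto
    then show ?thesis
      by (simp add: vec_eq_iff)
  qed
  then show ?thesis
    by (metis invertible_det_nz invertible_left_inverse matrix_left_invertible_ker)
qed

section \<open>Slice charts\<close>

locale slice_chart =
  fixes M U V :: "(real ^ 'm) set" and \<phi> \<psi> and J :: "'m set"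
  assumes diffeo: "diffeo U V \<phi> \<psi>"
    and slice: "\<phi> ` (M \<inter> U) = {y \<in> V. \<forall>i. i \<notin> J \<longrightarrow> y $ i = 0}"
begin

lemma open_U: "open U" and open_V: "open V"
  and smooth_\<phi>: "Cinf_on U \<phi>" and smooth_\<psi>: "Cinf_on V \<psi>"
  and \<psi>\<phi>: "x \<in> U \<Longrightarrow> \<psi> (\<phi> x) = x" and \<phi>_in: "x \<in> U \<Longrightarrow> \<phi> x \<in> V"
  using diffeo unfolding diffeo_def homeomorphism_def by auto

text \<open>Both differentials are indexed by the point \<open>q\<close> of the ambient space,
  although that of \<open>\<psi>\<close> is taken at the coordinate point
  \<open>\<phi> q\<close>.\<close>

abbreviation D\<psi> where "D\<psi> q \<equiv> frechet_derivative \<psi> (at (\<phi> q))"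
abbreviation D\<phi> where "D\<phi> q \<equiv> frechet_derivative \<phi> (at q)"

lemma D\<phi>: "q \<in> U \<Longrightarrow> (\<phi> has_derivative D\<phi> q) (at q)"
  using smooth_\<phi> Cinf_on_has_derivative by blast

lemma D\<psi>: "q \<in> U \<Longrightarrow> (\<psi> has_derivative D\<psi> q) (at (\<phi> q))"
  using smooth_\<psi> Cinf_on_has_derivative \<phi>_in by blast

lemma linear_D\<psi>: "q \<in> U \<Longrightarrow> linear (D\<psi> q)"
  using D\<psi> has_derivative_linear by blast

lemma D\<psi>_D\<phi>:
  assumes "q \<in> U"
  shows "D\<psi> q (D\<phi> q v) = v"
proof -
  have "((\<lambda>x. \<psi> (\<phi> x)) has_derivative (\<lambda>v. D\<psi> q (D\<phi> q v))) (at q)"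
    using D\<phi>[OF assms] D\<psi>[OF assms] by (rule has_derivative_compose)
  then have "((\<lambda>x. x) has_derivative (\<lambda>v. D\<psi> q (D\<phi> q v))) (at q)"
    by (rule has_derivative_transform_within_open[OF _ open_U assms]) (simp add: \<psi>\<phi>)
  then show ?thesis
    using has_derivative_unique[OF has_derivative_ident] by metis
qed

text \<open>The right inverse \<open>D\<phi> q\<close> makes \<open>D\<psi> q\<close> surjective,
  and a surjective linear endomorphism in finite dimension is injective.\<close>

lemma D\<psi>_eq_0_iff:
  assumes "q \<in> U"
  shows "D\<psi> q u = 0 \<longleftrightarrow> u = 0"
proof -
  have "surj (D\<psi> q)"
    using D\<psi>_D\<phi>[OF assms] by (metis surjI)
  then have "inj (D\<psi> q)"
    using linear_surjective_imp_injective linear_D\<psi>[OF assms] by blast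
  then show ?thesis
    using linear_D\<psi>[OF assms] linear_injective_0 linear_0 by metis
qed

text \<open>A curve in \<open>M\<close>, read in the chart, stays in the slice, so its velocity has
  no components outside \<open>J\<close>. Conversely, a straight line in the slice is carried by
  \<open>\<psi>\<close> to a curve in \<open>M\<close>. This turns the curve definition of tangent
  vectors into linear algebra.\<close>

lemma tangent_space_eq:
  assumes q: "q \<in> M \<inter> U"
  shows "tangent_space M q = D\<psi> q ` {u. \<forall>i. i \<notin> J \<longrightarrow> u $ i = 0}"
proof (intro equalityI subsetI)
  fix v assume "v \<in> tangent_space M q"
  then obtain \<gamma> e where \<gamma>: "e > 0" "\<gamma> ` {-e<..<e} \<subseteq> M" "\<gamma> 0 = q"
    "(\<gamma> has_vector_derivative v) (at 0)"
    unfolding tangent_space_def curve_in_def by blast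
  have "(\<phi> has_derivative D\<phi> q) (at (\<gamma> 0))"
    using D\<phi> q \<gamma>(3) by simp
  from has_derivative_compose[OF \<gamma>(4)[unfolded has_vector_derivative_def] this]
  have d: "((\<lambda>t. \<phi> (\<gamma> t)) has_derivative (\<lambda>t. D\<phi> q (t *\<^sub>R v))) (at 0)" .
  have "D\<phi> q v $ i = 0" if "i \<notin> J" for i
  proof -
    \<comment> \<open>The curve is only known to lie in \<open>M\<close>; continuity keeps it inside
      the chart domain \<open>U\<close> for small times.\<close>
    have "isCont \<gamma> 0"
      using \<gamma>(4) has_vector_derivative_continuous by blast
    then have "\<forall>\<^sub>F t in nhds 0. \<gamma> t \<in> U"
      using topological_tendstoD[OF _ open_U] q \<gamma>(3)
      unfolding isCont_def eventually_nhds_conv_at by blast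
    moreover have "\<forall>\<^sub>F t in nhds 0. t \<in> {-e<..<e}"
      using \<gamma>(1) by (intro eventually_nhds_in_open) auto
    ultimately have "\<forall>\<^sub>F t in nhds 0. \<phi> (\<gamma> t) $ i = 0"
    proof eventually_elim
      case (elim t)
      then have "\<phi> (\<gamma> t) \<in> \<phi> ` (M \<inter> U)"
        using \<gamma>(2) by blast
      then show ?case
        using that unfolding slice by blast
    qed
    then obtain S where S: "open S" "0 \<in> S" "\<And>t. t \<in> S \<Longrightarrow> \<phi> (\<gamma> t) $ i = 0"
      unfolding eventually_nhds by blast
    \<comment> \<open>This coordinate is identically zero near time 0, so uniqueness of derivatives
      forces its derivative to be zero.\<close>
    have "((\<lambda>t. \<phi> (\<gamma> t) $ i) has_derivative (\<lambda>t. D\<phi> q (t *\<^sub>R v) $ i)) (at 0)"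
      using bounded_linear.has_derivative[OF bounded_linear_vec_nth d] .
    then have "((\<lambda>t. 0) has_derivative (\<lambda>t. D\<phi> q (t *\<^sub>R v) $ i)) (at (0::real))"
      by (rule has_derivative_transform_within_open[OF _ S(1,2)]) (simp add: S(3))
    then have "(\<lambda>t::real. D\<phi> q (t *\<^sub>R v) $ i) = (\<lambda>t. 0)"
      using has_derivative_unique[OF _ has_derivative_const] by blast
    from fun_cong[OF this, of 1] show ?thesis
      by simp
  qed
  then show "v \<in> D\<psi> q ` {u. \<forall>i. i \<notin> J \<longrightarrow> u $ i = 0}"
    using D\<psi>_D\<phi>[of q v] q by (auto intro!: image_eqI[of _ _ "D\<phi> q v"])
next
  fix v assume "v \<in> D\<psi> q ` {u. \<forall>i. i \<notin> J \<longrightarrow> u $ i = 0}"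
  then obtain u where u: "\<And>i. i \<notin> J \<Longrightarrow> u $ i = 0" and v: "v = D\<psi> q u"
    by blast
  \<comment> \<open>The line through \<open>\<phi> q\<close> in direction \<open>u\<close>. Both
    vectors vanish outside \<open>J\<close>, so the line satisfies the slice equations; openness of
    \<open>V\<close> keeps it in the chart for small \<open>t\<close>.\<close>
  let ?c = "\<lambda>t. \<phi> q + t *\<^sub>R u"
  have "open (?c -` V)"
    by (intro open_vimage open_V continuous_intros)
  moreover have "0 \<in> ?c -` V"
    using \<phi>_in q by simp
  ultimately obtain e where e: "e > 0" "ball 0 e \<subseteq> ?c -` V"
    by (meson open_contains_ball)
  have eV: "?c ` {-e<..<e} \<subseteq> V"
    using e(2) by (auto simp: subset_iff dist_real_def)
  have "Cinf_on {-e<..<e} ?c"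
    unfolding Cinf_on_def
    by (intro allI Ck_on_add Ck_on_const Ck_on_bounded_linear bounded_linear_scaleR_left) auto
  then have "Cinf_on {-e<..<e} (\<lambda>t. \<psi> (?c t))"
    by (rule Cinf_on_compose[OF open_greaterThanLessThan eV _ smooth_\<psi>])
  moreover have "\<psi> (?c t) \<in> M" if "t \<in> {-e<..<e}" for t
  proof -
    have "\<phi> q \<in> \<phi> ` (M \<inter> U)"
      using q by blast
    moreover have "?c t \<in> V"
      using eV that by blast
    ultimately have "?c t \<in> \<phi> ` (M \<inter> U)"
      unfolding slice using u by simp
    then show ?thesis
      using \<psi>\<phi> by auto
  qed
  moreover have "((\<lambda>t. \<psi> (?c t)) has_vector_derivative v) (at 0)"
  proof -
    have "(?c has_derivative (\<lambda>t. t *\<^sub>R u)) (at 0)"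
      by (auto intro!: derivative_eq_intros)
    moreover have "(\<psi> has_derivative D\<psi> q) (at (?c 0))"
      using D\<psi> q by simp
    ultimately have "((\<lambda>t. \<psi> (?c t)) has_derivative (\<lambda>t. D\<psi> q (t *\<^sub>R u))) (at 0)"
      by (rule has_derivative_compose)
    then show ?thesis
      unfolding has_vector_derivative_def v using linear_D\<psi> q by (simp add: linear_scale)
  qed
  ultimately have "curve_in M q v (\<lambda>t. \<psi> (?c t))"
    unfolding curve_in_def using e(1) \<psi>\<phi> q by (intro conjI exI[of _ e]) auto
  then show "v \<in> tangent_space M q"
    unfolding tangent_space_def by blast
qed

text \<open>The coordinate vector fields of the chart. Those with \<open>a\<close> in
  \<open>J\<close> form a frame of the tangent spaces of \<open>M\<close> over
  \<open>U\<close>.\<close>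

definition frame :: "'m \<Rightarrow> real ^ 'm \<Rightarrow> real ^ 'm" where
  "frame a q = D\<psi> q (axis a 1)"

lemma subspace_tangent_space: "q \<in> M \<inter> U \<Longrightarrow> subspace (tangent_space M q)"
  unfolding tangent_space_eq
  by (intro linear_subspace_image linear_D\<psi>) (auto simp: subspace_def)

lemma frame_tangent: "q \<in> M \<inter> U \<Longrightarrow> a \<in> J \<Longrightarrow> frame a q \<in> tangent_space M q"
  unfolding tangent_space_eq frame_def by (auto simp: axis_def)

text \<open>Reduces independence of the frame to injectivity of \<open>D\<psi> q\<close>, and
  spanning to the description of the tangent space as an image under
  \<open>D\<psi> q\<close>.\<close>

lemma sum_frame:
  assumes "q \<in> U"
  shows "(\<Sum>a\<in>J. c $ a *\<^sub>R frame a q) = D\<psi> q (\<chi> a. if a \<in> J then c $ a else 0)"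
proof -
  have "(\<chi> a. if a \<in> J then c $ a else 0) = (\<Sum>a\<in>J. c $ a *\<^sub>R axis a 1)"
    by (simp add: vec_eq_iff axis_def if_distrib sum.delta cong: if_cong)
  then show ?thesis
    using linear_D\<psi>[OF assms] by (simp add: frame_def linear_sum linear_scale)
qed

lemma frame_independent:
  assumes "q \<in> U" "(\<Sum>a\<in>J. c $ a *\<^sub>R frame a q) = 0"
  shows "\<forall>a\<in>J. c $ a = 0"
proof -
  have "D\<psi> q (\<chi> a. if a \<in> J then c $ a else 0) = 0"
    using assms(2) unfolding sum_frame[OF assms(1)] .
  then have "(\<chi> a. if a \<in> J then c $ a else 0) = 0"
    unfolding D\<psi>_eq_0_iff[OF assms(1)] .
  then have "(\<chi> a. if a \<in> J then c $ a else 0) $ a = 0" for a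
    by (simp only: zero_index)
  then show ?thesis
    unfolding vec_lambda_beta by meson
qed

lemma frame_spans:
  assumes "q \<in> M \<inter> U" "v \<in> tangent_space M q"
  obtains c where "v = (\<Sum>a\<in>J. c $ a *\<^sub>R frame a q)"
proof -
  obtain u where u: "\<And>i. i \<notin> J \<Longrightarrow> u $ i = 0" "v = D\<psi> q u"
    using assms unfolding tangent_space_eq[OF assms(1)] by blast
  then have "(\<chi> a. if a \<in> J then u $ a else 0) = u"
    by (auto simp: vec_eq_iff)
  then show ?thesis
    using that[of u] sum_frame[of q u] u(2) assms(1) by simp
qed

lemma smooth_map_frame: "smooth_map (M \<inter> U) (frame a)"
proof (rule smooth_mapI_Cinf_on[OF open_U])
  show "Cinf_on U (frame a)"
    unfolding frame_def using \<phi>_in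
    by (intro Cinf_on_compose[OF open_U _ smooth_\<phi> Cinf_on_frechet_derivative[OF smooth_\<psi>]]
        image_subsetI)
qed auto

lemma smooth_vector_field_frame:
  assumes "a \<in> J"
  shows "smooth_vector_field (M \<inter> U) (frame a)"
proof -
  \<comment> \<open>The same chart is a slice chart of \<open>M \<inter> U\<close>, so tangency to
    this smaller set follows without comparing its tangent spaces with those of
    \<open>M\<close>.\<close>
  interpret N: slice_chart "M \<inter> U" U V \<phi> \<psi> J
    using diffeo slice unfolding slice_chart_def Int_assoc Int_absorb by blast
  have "frame a q \<in> tangent_space (M \<inter> U) q" if "q \<in> M \<inter> U" for q
    by (rule N.frame_tangent) (use that assms in auto)
  then show ?thesis
    unfolding smooth_vector_field_def by (intro conjI ballI smooth_map_frame)
qed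

end

lemma embedded_submanifold_chart:
  fixes M :: "(real ^ 'm) set"
  assumes "embedded_submanifold k M" "p \<in> M"
  obtains U V \<phi> \<psi> and J :: "'m set" where "slice_chart M U V \<phi> \<psi> J" "p \<in> U"
  using bspec[OF assms(1)[unfolded embedded_submanifold_def] assms(2)]
  by (elim exE conjE) (rule that[OF slice_chart.intro])

section \<open>Gradients of the coordinate functions\<close>

text \<open>The algebraic clauses are part of the metric; closure of the tangent space under linear
  combinations is not evident from curves and comes from a slice chart.\<close>

lemma riemannian_metric_inner_product_on:
  fixes M :: "(real ^ 'm) set"
  assumes "embedded_submanifold k M" "riemannian_metric M g" "p \<in> M"
  shows "inner_product_on (tangent_space M p) (g p)"
proof
  obtain U V \<phi> \<psi> and J :: "'m set" where "slice_chart M U V \<phi> \<psi> J" "p \<in> U"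
    by (rule embedded_submanifold_chart[OF assms(1,3)])
  then show "subspace (tangent_space M p)"
    using slice_chart.subspace_tangent_space assms(3) by blast
qed (use assms(2,3) in \<open>unfold riemannian_metric_def, blast\<close>)+

text \<open>A coordinate is linear, so its derivative along every curve with velocity
  \<open>v\<close> is \<open>v $ i\<close>. Existence of one such curve makes the value in
  \<open>differential\<close> unique.\<close>

lemma differential_coordinate:
  fixes M :: "(real ^ 'm) set"
  assumes "v \<in> tangent_space M p"
  shows "differential M (\<lambda>x. x $ i) p v = v $ i"
proof -
  have d: "((\<lambda>t. \<gamma> t $ i) has_real_derivative v $ i) (at 0)" if "curve_in M p v \<gamma>" for \<gamma>
    using that bounded_linear.has_vector_derivative[OF bounded_linear_vec_nth]
    unfolding curve_in_def has_real_derivative_iff_has_vector_derivative by blast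
  obtain \<gamma> where "curve_in M p v \<gamma>"
    using assms unfolding tangent_space_def by blast
  with d show ?thesis
    unfolding differential_def by (intro the_equality) (blast intro: DERIV_unique)+
qed

text \<open>Nondegeneracy of the metric gives the uniqueness that the definite description in
  \<open>grad\<close> demands, so exhibiting a representing vector suffices.\<close>

lemma grad_coordinate_eqI:
  fixes M :: "(real ^ 'm) set"
  assumes "inner_product_on (tangent_space M p) (g p)"
    and "w \<in> tangent_space M p" "\<And>v. v \<in> tangent_space M p \<Longrightarrow> g p w v = v $ i"
  shows "grad M g (\<lambda>x. x $ i) p = w"
  unfolding grad_def
proof (rule the_equality)
  show "w \<in> tangent_space M p \<and>
      (\<forall>v\<in>tangent_space M p. g p w v = differential M (\<lambda>x. x $ i) p v)"
    using assms by (simp add: differential_coordinate)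
  fix w' assume "w' \<in> tangent_space M p \<and>
      (\<forall>v\<in>tangent_space M p. g p w' v = differential M (\<lambda>x. x $ i) p v)"
  then show "w' = w"
    using assms by (intro inner_product_on.eqI[OF assms(1)]) (auto simp: differential_coordinate)
qed

text \<open>A smooth representing field is built over each chart domain and identified there with
  the gradient. As \<open>grad\<close> is defined globally, the local pieces agree automatically and
  smoothness follows by locality.\<close>

lemma grad_coordinate:
  fixes M :: "(real ^ 'm) set"
  assumes M: "embedded_submanifold k M" and g: "riemannian_metric M g"
  shows smooth_vector_field_grad_coordinate: "smooth_vector_field M (grad M g (\<lambda>x. x $ i))"
    and metric_grad_coordinate:
      "\<And>p v. p \<in> M \<Longrightarrow> v \<in> tangent_space M p \<Longrightarrow> g p (grad M g (\<lambda>x. x $ i) p) v = v $ i"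
proof -
  let ?G = "grad M g (\<lambda>x. x $ i)"
  have local: "\<exists>U. open U \<and> p \<in> U \<and> smooth_map (M \<inter> U) ?G \<and> ?G p \<in> tangent_space M p \<and>
      (\<forall>v\<in>tangent_space M p. g p (?G p) v = v $ i)" if "p \<in> M" for p
  proof -
    obtain U V \<phi> \<psi> and J :: "'m set" where chart: "slice_chart M U V \<phi> \<psi> J" and p: "p \<in> U"
      by (rule embedded_submanifold_chart[OF M \<open>p \<in> M\<close>])
    interpret slice_chart M U V \<phi> \<psi> J
      by (fact chart)
    let ?A = "\<lambda>q. gram (g q) J (\<lambda>a. frame a q)"
    \<comment> \<open>Entry \<open>a\<close> in \<open>J\<close> is the differential of the
      coordinate on \<open>frame a q\<close>. The zeros elsewhere match the identity padding of the
      Gram matrix.\<close>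
    let ?b = "\<lambda>q. \<chi> a. if a \<in> J then frame a q $ i else 0"
    have "smooth_map (M \<inter> U) (\<lambda>q. g q (frame a q) (frame b q))" if "a \<in> J" "b \<in> J" for a b
      using g open_U smooth_vector_field_frame that unfolding riemannian_metric_def by blast
    then have A: "smooth_map (M \<inter> U) (\<lambda>q. ?A q $ a $ b)" for a b
      by (cases "a \<in> J"; cases "b \<in> J"; cases "a = b") (simp_all add: gram_def smooth_map_const)
    have b: "smooth_map (M \<inter> U) (\<lambda>q. ?b q $ a)" for a
      by (cases "a \<in> J") (simp_all add: smooth_map_const smooth_map_vec_nth smooth_map_frame)
    have nz: "det (?A q) \<noteq> 0" if "q \<in> M \<inter> U" for q
    proof -
      interpret inner_product_on "tangent_space M q" "g q"
        using riemannian_metric_inner_product_on[OF M g] that by blast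
      show ?thesis
        using frame_tangent frame_independent that by (intro det_gram_nonzero) auto
    qed
    obtain c where "(\<forall>a. smooth_map (M \<inter> U) (\<lambda>q. c q $ a)) \<and> (\<forall>q\<in>M \<inter> U. ?A q *v c q = ?b q)"
      using smooth_map_linear_system[of "M \<inter> U" ?A ?b, OF A b nz] by (rule exE)
    then have c: "\<And>a. smooth_map (M \<inter> U) (\<lambda>q. c q $ a)"
      and Ac: "\<And>q. q \<in> M \<inter> U \<Longrightarrow> ?A q *v c q = ?b q"
      by simp_all
    define w where "w q = (\<Sum>a\<in>J. c q $ a *\<^sub>R frame a q)" for q
    have w: "w q \<in> tangent_space M q \<and> (\<forall>v\<in>tangent_space M q. g q (w q) v = v $ i) \<and> ?G q = w q"
      if q: "q \<in> M \<inter> U" for q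
    proof -
      interpret inner_product_on "tangent_space M q" "g q"
        using riemannian_metric_inner_product_on[OF M g] q by blast
      have wT: "w q \<in> tangent_space M q"
        unfolding w_def using frame_tangent[OF q] by (rule sum_in)
      have wB: "g q (w q) (frame a q) = frame a q $ i" if "a \<in> J" for a
      proof -
        have "g q (w q) (frame a q) = g q (frame a q) (w q)"
          using wT frame_tangent[OF q that] by (rule sym)
        also have "\<dots> = (?A q *v c q) $ a"
          unfolding w_def using frame_tangent[OF q] that
          by (simp add: sum_right gram_mult_in mult.commute)
        finally show ?thesis
          using Ac[OF q] that by simp
      qed
      \<comment> \<open>The frame spans, so the identity on frame vectors extends by linearity in
        the second argument.\<close>
      have wv: "g q (w q) v = v $ i" if v: "v \<in> tangent_space M q" for v
      proof -
        obtain d where "v = (\<Sum>a\<in>J. d $ a *\<^sub>R frame a q)"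
          using frame_spans[OF q v] by blast
        then show ?thesis
          using frame_tangent[OF q] wT wB by (simp add: sum_right)
      qed
      show ?thesis
        using wT wv grad_coordinate_eqI[of M q g, OF inner_product_on_axioms wT wv] by simp
    qed
    have "smooth_map (M \<inter> U) w"
      unfolding w_def by (intro smooth_map_sum smooth_map_scaleR c smooth_map_frame)
    then have "smooth_map (M \<inter> U) ?G"
      by (rule smooth_map_cong) (use w in simp)
    then show ?thesis
      using w[of p] p \<open>p \<in> M\<close> open_U by auto
  qed
  have "smooth_map M ?G"
    by (rule smooth_map_local) (use local in blast)
  then show "smooth_vector_field M ?G"
    unfolding smooth_vector_field_def using local by blast
  show "\<And>p v. p \<in> M \<Longrightarrow> v \<in> tangent_space M p \<Longrightarrow> g p (?G p) v = v $ i"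
    using local by blast
qed

section \<open>The Euclidean metric and the global decomposition of vector fields\<close>

lemma riemannian_metric_inner:
  fixes M :: "'a::euclidean_space set"
  shows "riemannian_metric M (\<lambda>_. (\<bullet>))"
  unfolding riemannian_metric_def
proof (intro conjI ballI allI impI)
  show "u \<bullet> v = v \<bullet> u" for u v :: 'a
    by (rule inner_commute)
  show "smooth_map (M \<inter> W) (\<lambda>p. X p \<bullet> Y p)"
    if "open W \<and> smooth_vector_field (M \<inter> W) X \<and> smooth_vector_field (M \<inter> W) Y" for W X Y
    using that unfolding smooth_vector_field_def by (intro smooth_map_inner) simp_all
qed (simp_all add: inner_add_left)

theorem mainTheorem7:
  fixes M :: "(real ^ 'm) set"
    and k :: nat
    and g :: "real ^ 'm \<Rightarrow> real ^ 'm \<Rightarrow> real ^ 'm \<Rightarrow> real"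
  assumes "embedded_submanifold k M"
    and "riemannian_metric M g"
  shows "generating_set M (\<lambda>i. grad M g (\<lambda>x. x $ i))"
  unfolding generating_set_def
proof (intro conjI allI impI)
  let ?G = "\<lambda>i. grad M g (\<lambda>x. x $ i)"
  let ?P = "\<lambda>i. grad M (\<lambda>_. (\<bullet>)) (\<lambda>x. x $ i)"
  show G: "smooth_vector_field M (?G i)" for i
    using assms by (rule smooth_vector_field_grad_coordinate)
  have P: "smooth_vector_field M (?P i)" for i
    using assms(1) riemannian_metric_inner by (rule smooth_vector_field_grad_coordinate)
  fix X assume X: "smooth_vector_field M X"
  let ?f = "\<lambda>i p. g p (X p) (?P i p)"
  \<comment> \<open>The smoothness clause of the metric, taken with the whole space as open set,
    applies because \<open>X\<close> and \<open>?P i\<close> are smooth fields on all of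
    \<open>M\<close>.\<close>
  have "smooth_map (M \<inter> UNIV) (?f i)" for i
    using assms(2) X P unfolding riemannian_metric_def by (metis Int_UNIV_right open_UNIV)
  moreover have "X p = (\<Sum>i\<in>UNIV. ?f i p *\<^sub>R ?G i p)" if p: "p \<in> M" for p
  proof -
    interpret inner_product_on "tangent_space M p" "g p"
      using riemannian_metric_inner_product_on[OF assms p] .
    interpret E: inner_product_on "tangent_space M p" "(\<bullet>)"
      using riemannian_metric_inner_product_on[OF assms(1) riemannian_metric_inner p] .
    have GT: "?G i p \<in> tangent_space M p" and PT: "?P i p \<in> tangent_space M p"
      and XT: "X p \<in> tangent_space M p" for i
      using G P X p unfolding smooth_vector_field_def by blast+
    \<comment> \<open>The sum is the projection of \<open>v\<close>, which fixes tangent vectors.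
      Against tangent \<open>u\<close>, each \<open>?P i p\<close> reads off \<open>u $ i\<close>,
      so both sides pair to the usual dot product of \<open>v\<close> and \<open>u\<close>.\<close>
    have P_sum: "(\<Sum>i\<in>UNIV. v $ i *\<^sub>R ?P i p) = v" if v: "v \<in> tangent_space M p" for v
    proof (rule E.eqI[OF E.sum_in[OF PT] v])
      fix u assume "u \<in> tangent_space M p"
      then have "(\<Sum>i\<in>UNIV. v $ i *\<^sub>R ?P i p) \<bullet> u = (\<Sum>i\<in>UNIV. v $ i * u $ i)"
        using metric_grad_coordinate[OF assms(1) riemannian_metric_inner p]
        by (simp add: inner_sum_left)
      then show "(\<Sum>i\<in>UNIV. v $ i *\<^sub>R ?P i p) \<bullet> u = v \<bullet> u"
        by (simp add: inner_vec_def)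
    qed
    show ?thesis
    proof (rule eqI[OF XT sum_in[OF GT]])
      fix v assume v: "v \<in> tangent_space M p"
      \<comment> \<open>The weights \<open>v $ i\<close> of this expansion are also the values of
        the pairing of \<open>?G i p\<close> with \<open>v\<close>; exchanging the roles of weight
        and pairing moves the expansion from \<open>v\<close> to \<open>X p\<close>.\<close>
      have "g p (X p) v = g p (X p) (\<Sum>i\<in>UNIV. v $ i *\<^sub>R ?P i p)"
        using P_sum[OF v] by simp
      also have "\<dots> = (\<Sum>i\<in>UNIV. v $ i * ?f i p)"
        using PT XT by (rule sum_right)
      also have "\<dots> = g p (\<Sum>i\<in>UNIV. ?f i p *\<^sub>R ?G i p) v"
        using v GT metric_grad_coordinate[OF assms p v] by (simp add: sum_left mult.commute)
      finally show "g p (X p) v = g p (\<Sum>i\<in>UNIV. ?f i p *\<^sub>R ?G i p) v" .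
    qed
  qed
  ultimately show "\<exists>f. (\<forall>i. smooth_map M (f i)) \<and> (\<forall>p\<in>M. X p = (\<Sum>i\<in>UNIV. f i p *\<^sub>R ?G i p))"
    by (intro exI[of _ ?f]) simp
qed

end
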